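(* Let $\psi:T\to\mathbb{C}$ be such that $M_\psi$ is a bounded multiplication operator from $\mathcal{L}_{\mathbf{w}}$ to $\mathcal{L}$, and define $$A(\psi)=\lim_{n\to\infty}\sup_{|v|\ge n}\frac{|\psi(v)|}{|v|+1},\qquad B(\psi)=\lim_{n\to\infty}\sup_{|v|\ge n}D\psi(v)\log|v|.$$ Then $$\|M_\psi\|_e\le A(\psi)+B(\psi).$$
   Context: $T$ is the vertex set of a tree (a locally finite, connected, simply connected graph), rooted at a vertex $o$ and without terminal vertices (a terminal vertex is one having a unique neighbor), hence infinite. $|v|$ is the number of edges in the path from $o$ to $v$; $T^*=T\setminus\{o\}$; for $v\in T^*$, $v^-$ is the neighbor of $v$ closest to $o$. For $f:T\to\mathbb{C}$ and $v\in T^*$, $Df(v)=|f(v)-f(v^-)|$. The Lipschitz space $\mathcal{L}$ is the Banach space of all $f:T\to\mathbb{C}$ with $\sup_{v\in T^*}Df(v)<\infty$, with norm $\|f\|_{\mathcal{L}}=|f(o)|+\sup_{v\in T^*}Df(v)$. The weighted Lipschitz space $\mathcal{L}_{\mathbf{w}}$ is the Banach space of all $f:T\to\mathbb{C}$ with $\sup_{v\in T^*}|v|Df(v)<\infty$, with norm $\|f\|_{\mathbf{w}}=|f(o)|+\sup_{v\in T^*}|v|Df(v)$. For $\psi:T\to\mathbb{C}$, $M_\psi f=\psi f$ (pointwise product). "$M_\psi:X\to Y$ is bounded" means that $\psi f\in Y$ for all $f\in X$ and $M_\psi$ is a bounded linear operator. The essential norm of a bounded operator $S:X\to Y$ between Banach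 spaces is $\|S\|_e=\inf\{\|S-K\|:K\text{ is a compact operator from }X\text{ to }Y\}$. *)

theory Defs
  imports "HOL-Analysis.Analysis"
begin

text \<open>The vertex set of the tree is the whole type \<open>'v\<close>, so that functions on the tree
  are exactly the functions of type \<open>'v \<Rightarrow> complex\<close>.\<close>

definition path_between :: "('v \<Rightarrow> 'v \<Rightarrow> bool) \<Rightarrow> 'v \<Rightarrow> 'v list \<Rightarrow> 'v \<Rightarrow> bool" where
  "path_between adj u p v \<longleftrightarrow>
     p \<noteq> [] \<and> hd p = u \<and> last p = v \<and> distinct p \<and> successively adj p"

definition graph_cycle :: "('v \<Rightarrow> 'v \<Rightarrow> bool) \<Rightarrow> 'v list \<Rightarrow> bool" where
  "graph_cycle adj p \<longleftrightarrow>
     length p \<ge> 3 \<and> distinct p \<and> successively adj p \<and> adj (last p) (hd p)"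

text \<open>A graph is simply connected when it has no cycles. The one-vertex tree has no vertex
  with a unique neighbour, hence infinitude is required separately.\<close>

locale infinite_tree =
  fixes adj :: "'v \<Rightarrow> 'v \<Rightarrow> bool"
  assumes adj_sym: "adj u v \<Longrightarrow> adj v u"
    and adj_irrefl: "\<not> adj v v"
    and locally_finite: "finite {u. adj v u}"
    and connected: "\<exists>p. path_between adj u p v"
    and simply_connected: "\<not> graph_cycle adj p"
    and no_terminal: "\<not> (\<exists>!u. adj v u)"
    and infinite_vertices: "infinite (UNIV :: 'v set)"

definition depth :: "('v \<Rightarrow> 'v \<Rightarrow> bool) \<Rightarrow> 'v \<Rightarrow> 'v \<Rightarrow> nat" where
  "depth adj r v = length (THE p. path_between adj r p v) - 1"

definition parent :: "('v \<Rightarrow> 'v \<Rightarrow> bool) \<Rightarrow> 'v \<Rightarrow> 'v \<Rightarrow> 'v" where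
  "parent adj r v = (ARG_MIN (depth adj r) u. adj v u)"

text \<open>Only meaningful for \<open>v \<noteq> r\<close>.\<close>

definition tree_diff ::
    "('v \<Rightarrow> 'v \<Rightarrow> bool) \<Rightarrow> 'v \<Rightarrow> ('v \<Rightarrow> complex) \<Rightarrow> 'v \<Rightarrow> real" where
  "tree_diff adj r f v = cmod (f v - f (parent adj r v))"

text \<open>The spaces depend on the tree, so they are given by a carrier set and a norm that is
  meaningful on the carrier only.\<close>

record 'v fun_space =
  elems :: "('v \<Rightarrow> complex) set"
  fnorm :: "('v \<Rightarrow> complex) \<Rightarrow> real"

definition lipschitz_space :: "('v \<Rightarrow> 'v \<Rightarrow> bool) \<Rightarrow> 'v \<Rightarrow> 'v fun_space" where
  "lipschitz_space adj r =
     \<lparr> elems = {f. bdd_above (tree_diff adj r f ` (- {r}))},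
       fnorm = (\<lambda>f. cmod (f r) + (SUP v\<in>- {r}. tree_diff adj r f v)) \<rparr>"

definition weighted_lipschitz_space :: "('v \<Rightarrow> 'v \<Rightarrow> bool) \<Rightarrow> 'v \<Rightarrow> 'v fun_space" where
  "weighted_lipschitz_space adj r =
     \<lparr> elems = {f. bdd_above ((\<lambda>v. real (depth adj r v) * tree_diff adj r f v) ` (- {r}))},
       fnorm = (\<lambda>f. cmod (f r) + (SUP v\<in>- {r}. real (depth adj r v) * tree_diff adj r f v)) \<rparr>"

text \<open>The library's metric spaces require a nonnegative symmetric distance on the whole type,
  whence the value 0 outside the carrier.\<close>

definition fdist :: "'v fun_space \<Rightarrow> ('v \<Rightarrow> complex) \<Rightarrow> ('v \<Rightarrow> complex) \<Rightarrow> real" where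
  "fdist X f g = (if f \<in> elems X \<and> g \<in> elems X then fnorm X (\<lambda>v. f v - g v) else 0)"

definition ftopology :: "'v fun_space \<Rightarrow> ('v \<Rightarrow> complex) topology" where
  "ftopology X = Metric_space.mtopology (elems X) (fdist X)"

type_synonym 'v operator = "('v \<Rightarrow> complex) \<Rightarrow> 'v \<Rightarrow> complex"

definition linear_operator :: "'v fun_space \<Rightarrow> 'v fun_space \<Rightarrow> 'v operator \<Rightarrow> bool" where
  "linear_operator X Y S \<longleftrightarrow>
     (\<forall>f\<in>elems X. S f \<in> elems Y) \<and>
     (\<forall>f\<in>elems X. \<forall>g\<in>elems X. S (\<lambda>v. f v + g v) = (\<lambda>v. S f v + S g v)) \<and>
     (\<forall>c. \<forall>f\<in>elems X. S (\<lambda>v. c * f v) = (\<lambda>v. c * S f v))"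

definition bounded_operator :: "'v fun_space \<Rightarrow> 'v fun_space \<Rightarrow> 'v operator \<Rightarrow> bool" where
  "bounded_operator X Y S \<longleftrightarrow>
     linear_operator X Y S \<and> (\<exists>C. \<forall>f\<in>elems X. fnorm Y (S f) \<le> C * fnorm X f)"

definition closed_unit_ball :: "'v fun_space \<Rightarrow> ('v \<Rightarrow> complex) set" where
  "closed_unit_ball X = {f \<in> elems X. fnorm X f \<le> 1}"

definition operator_norm :: "'v fun_space \<Rightarrow> 'v fun_space \<Rightarrow> 'v operator \<Rightarrow> real" where
  "operator_norm X Y S = (SUP f\<in>closed_unit_ball X. fnorm Y (S f))"

definition compact_operator :: "'v fun_space \<Rightarrow> 'v fun_space \<Rightarrow> 'v operator \<Rightarrow> bool" where
  "compact_operator X Y K \<longleftrightarrow>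
     linear_operator X Y K \<and>
     compactin (ftopology Y) (ftopology Y closure_of (K ` closed_unit_ball X))"

definition essential_norm :: "'v fun_space \<Rightarrow> 'v fun_space \<Rightarrow> 'v operator \<Rightarrow> real" where
  "essential_norm X Y S =
     Inf {operator_norm X Y (\<lambda>f v. S f v - K f v) | K. compact_operator X Y K}"

definition mult_operator :: "('v \<Rightarrow> complex) \<Rightarrow> 'v operator" where
  "mult_operator \<psi> = (\<lambda>f v. \<psi> v * f v)"

text \<open>The suprema are taken in the extended reals, where the decreasing sequences below always
  have a limit. In \<open>B_limit\<close> the root, where the difference is not defined, is left out;
  this concerns the index \<open>n = 0\<close> only.\<close>

definition A_limit :: "('v \<Rightarrow> 'v \<Rightarrow> bool) \<Rightarrow> 'v \<Rightarrow> ('v \<Rightarrow> complex) \<Rightarrow> ereal" where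
  "A_limit adj r \<psi> =
     lim (\<lambda>n::nat. SUP v\<in>{v. n \<le> depth adj r v}.
       ereal (cmod (\<psi> v) / (real (depth adj r v) + 1)))"

definition B_limit :: "('v \<Rightarrow> 'v \<Rightarrow> bool) \<Rightarrow> 'v \<Rightarrow> ('v \<Rightarrow> complex) \<Rightarrow> ereal" where
  "B_limit adj r \<psi> =
     lim (\<lambda>n::nat. SUP v\<in>{v. v \<noteq> r \<and> n \<le> depth adj r v}.
       ereal (tree_diff adj r \<psi> v * ln (real (depth adj r v))))"

end

theory Submission
  imports Defs
begin

text \<open>Let \<open>K\<^sub>n f\<close> be \<open>\<psi>\<close> times the function which agrees with \<open>f\<close> up to depth \<open>n\<close> and is constant
  along the descendants of each vertex of depth \<open>n\<close>. It has finite rank because balls are finite,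
  hence it is compact. For \<open>f\<close> in the unit ball, the function \<open>g = f - f\<^sub>n\<close>, where \<open>f\<^sub>n\<close> is the
  truncation, vanishes up to depth \<open>n\<close>, has \<open>|v| Dg(v) \<le> 1\<close>, and satisfies \<open>|g(v)| \<le> log |v|\<close> by
  summing the harmonic series along the path from the ancestor of \<open>v\<close> at depth \<open>n\<close>. The product
  rule \<open>D(\<psi>g)(v) \<le> |\<psi>(v)| Dg(v) + D\<psi>(v) |g(v\<^sup>-)|\<close> then bounds \<open>M\<^sub>\<psi> - K\<^sub>n\<close>.\<close>

locale rooted_tree = infinite_tree adj for adj :: "'v \<Rightarrow> 'v \<Rightarrow> bool" +
  fixes r :: 'v
begin

abbreviation "dep \<equiv> depth adj r"
abbreviation "par \<equiv> parent adj r"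
abbreviation "Diff \<equiv> tree_diff adj r"
abbreviation "Lip \<equiv> lipschitz_space adj r"
abbreviation "WLip \<equiv> weighted_lipschitz_space adj r"

subsection \<open>Depth and parents\<close>

text \<open>Induction strips common initial vertices. Where the paths separate they must meet again,
  since their ends agree; following the first up to its first vertex \<open>y\<close> on the second,
  then the second backwards, closes a cycle.\<close>

lemma path_unique:
  "path_between adj u p v \<Longrightarrow> path_between adj u q v \<Longrightarrow> p = q"
proof (induction p arbitrary: u q)
  case Nil
  then show ?case by (simp add: path_between_def)
next
  case (Cons a p')
  then have a: "a = u" by (simp add: path_between_def)
  from Cons.prems(2) obtain q' where q: "q = u # q'"
    by (cases q) (auto simp: path_between_def)
  show ?case
  proof (cases "p' = [] \<or> q' = []")
    case True
    then show ?thesis using Cons.prems a q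
      by (auto simp: path_between_def split: if_splits)
  next
    case False
    then have ne: "p' \<noteq> []" "q' \<noteq> []" by auto
    have P: "last p' = v" "distinct p'" "u \<notin> set p'" "successively adj p'" "adj u (hd p')"
      using Cons.prems(1) a ne by (auto simp: path_between_def successively_Cons)
    have Q: "last q' = v" "distinct q'" "u \<notin> set q'" "successively adj q'" "adj u (hd q')"
      using Cons.prems(2) q ne by (auto simp: path_between_def successively_Cons)
    show ?thesis
    proof (cases "hd p' = hd q'")
      case True
      then have "p' = q'"
        using Cons.IH[of "hd p'" q'] P Q ne by (auto simp: path_between_def)
      then show ?thesis using a q by simp
    next
      case False
      have "\<exists>x\<in>set p'. x \<in> set q'" using P(1) Q(1) ne last_in_set by metis
      then obtain ps y ps2 where ps: "p' = ps @ y # ps2" "y \<in> set q'" "\<forall>x\<in>set ps. x \<notin> set q'"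
        using split_list_first_prop[of p' "\<lambda>x. x \<in> set q'"] by blast
      obtain qs qs2 where qs: "q' = qs @ y # qs2" using ps(2) by (meson split_list)
      let ?c = "u # ps @ y # rev qs"
      have rev: "successively adj (rev xs) = successively adj xs" for xs
        unfolding successively_rev using adj_sym
        by (metis successively_mono)
      \<comment> \<open>The paths separate right after \<open>u\<close>, so \<open>ps\<close> and
        \<open>qs\<close> are not both empty; this yields the third vertex.\<close>
      have "length ?c \<ge> 3" using False ps qs by (cases ps; cases qs) auto
      moreover have "distinct ?c" using P Q ps qs by auto
      moreover have "successively adj ?c"
      proof -
        have "successively adj ((u # ps @ [y]) @ ps2)"
          using P(4,5) ne unfolding ps(1) by (simp add: successively_Cons)
        then have 1: "successively adj (u # ps @ [y])"
          unfolding successively_append_iff by blast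
        have "successively adj (qs @ [y])"
          using Q(4) unfolding qs by (auto simp: successively_append_iff)
        then have "successively adj (rev (qs @ [y]))" using rev by blast
        then have 2: "successively adj (rev qs)" "rev qs \<noteq> [] \<Longrightarrow> adj y (hd (rev qs))"
          by (auto simp: successively_Cons)
        have "last (u # ps @ [y]) = y" by simp
        with 1 2 have "successively adj ((u # ps @ [y]) @ rev qs)"
          unfolding successively_append_iff by metis
        then show ?thesis by simp
      qed
      moreover have "adj (last ?c) (hd ?c)"
        using Q(5) adj_sym unfolding qs by (cases qs) auto
      ultimately show ?thesis using simply_connected[of ?c] by (simp add: graph_cycle_def)
    qed
  qed
qed

lemma dep_eq: "path_between adj r p v \<Longrightarrow> dep v = length p - 1"
  unfolding depth_def using path_unique by (metis the_equality)

lemma dep_root [simp]: "dep r = 0"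
  using dep_eq[of "[r]" r] by (simp add: path_between_def)

text \<open>By uniqueness any path from the root computes the depth. A path to \<open>u\<close> is
  prolonged by \<open>v\<close> or, if it already passes through \<open>v\<close>, cut off
  there.\<close>

lemma dep_adj: assumes "adj v u" shows "dep v \<le> Suc (dep u)"
proof -
  obtain q where q: "path_between adj r q u" using connected by blast
  show ?thesis
  proof (cases "v \<in> set q")
    case False
    have "path_between adj r (q @ [v]) v"
      using q False assms adj_sym by (auto simp: path_between_def successively_append_iff)
    from dep_eq[OF this] dep_eq[OF q] show ?thesis by auto
  next
    case True
    then obtain a b where ab: "q = a @ v # b" by (meson split_list)
    have "successively adj ((a @ [v]) @ b)" using q ab by (simp add: path_between_def)
    then have "successively adj (a @ [v])" unfolding successively_append_iff by blast
    then have "path_between adj r (a @ [v]) v"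
      using q unfolding ab path_between_def by (cases a) auto
    from dep_eq[OF this] dep_eq[OF q] show ?thesis using ab by auto
  qed
qed

text \<open>The vertex before \<open>v\<close> on the path from the root has depth one less than
  \<open>v\<close>, and \<open>dep_adj\<close> allows no neighbour a smaller depth; hence the
  minimising neighbour has exactly this depth.\<close>

lemma parent_props:
  assumes "v \<noteq> r" shows "adj v (par v)" "dep v = Suc (dep (par v))"
proof -
  obtain q where q: "path_between adj r q v" using connected by blast
  then obtain p where p: "q = p @ [v]"
    by (metis append_butlast_last_id path_between_def)
  have ne: "p \<noteq> []" using q p assms by (auto simp: path_between_def)
  have w: "path_between adj r p (last p)"
    using q ne unfolding p path_between_def by (auto simp: successively_append_iff)
  have adj: "adj v (last p)"
    using q ne adj_sym unfolding p path_between_def by (auto simp: successively_append_iff)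
  have d: "dep v = Suc (dep (last p))"
    using dep_eq[OF q] dep_eq[OF w] p ne by (cases p) auto
  have m: "adj v (par v) \<and> (\<forall>u. adj v u \<longrightarrow> dep (par v) \<le> dep u)"
    unfolding parent_def using arg_min_nat_lemma[of "adj v" "last p" dep] adj by blast
  then show "adj v (par v)" by blast
  have "dep (par v) \<le> dep (last p)" using m adj by blast
  then show "dep v = Suc (dep (par v))" using dep_adj[of v "par v"] m d by linarith
qed

lemma dep_pos: "v \<noteq> r \<Longrightarrow> dep v > 0"
  using parent_props by simp

lemma dep_induct [case_names root step]:
  assumes "P r" "\<And>v. v \<noteq> r \<Longrightarrow> P (par v) \<Longrightarrow> P v"
  shows "P v"
  by (induction "dep v" arbitrary: v rule: less_induct) (metis assms parent_props(2) lessI)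

text \<open>Apart from the root, each ball consists of neighbours of vertices in the next smaller
  ball. This finiteness gives the truncated operators finite rank.\<close>

lemma finite_dep_le: "finite {v. dep v \<le> n}"
proof (induction n)
  case 0
  have "{v. dep v \<le> 0} \<subseteq> {r}" using dep_pos by fastforce
  then show ?case by (rule finite_subset) simp
next
  case (Suc n)
  have "{v. dep v \<le> Suc n} \<subseteq> insert r (\<Union>u\<in>{u. dep u \<le> n}. {v. adj u v})"
  proof
    fix v assume "v \<in> {v. dep v \<le> Suc n}"
    then show "v \<in> insert r (\<Union>u\<in>{u. dep u \<le> n}. {v. adj u v})"
      using parent_props[of v] adj_sym by (cases "v = r") auto
  qed
  then show ?case by (rule finite_subset) (use Suc locally_finite in auto)
qed

lemma ex_dep_gt: "\<exists>v. dep v > n"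
proof (rule ccontr)
  assume "\<nexists>v. dep v > n"
  then have "{v. dep v \<le> n} = UNIV" by (auto simp: not_less)
  then show False using finite_dep_le[of n] infinite_vertices by simp
qed

lemma nonroot_nonempty: "- {r} \<noteq> {}"
  using ex_dep_gt[of 0] by (metis ComplI dep_root empty_iff less_irrefl singletonD)

section \<open>Truncation along ancestors\<close>

definition anc :: "nat \<Rightarrow> 'v \<Rightarrow> 'v" where
  "anc n v = (par ^^ (dep v - n)) v"

text \<open>Subtraction of natural numbers stops at 0, so no step towards the root is taken.\<close>

lemma anc_low: "dep v \<le> n \<Longrightarrow> anc n v = v"
  by (simp add: anc_def)

lemma anc_high: assumes "dep v > n" shows "anc n v = anc n (par v)"
proof -
  have "v \<noteq> r" using assms by auto
  then have "dep v - n = Suc (dep (par v) - n)" using parent_props[of v] assms by simp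
  then show ?thesis by (simp add: anc_def funpow_swap1)
qed

lemma dep_anc_le: "dep (anc n v) \<le> n"
proof (induction v rule: dep_induct)
  case root
  then show ?case by (simp add: anc_low)
next
  case (step v)
  then show ?case by (cases "dep v \<le> n") (auto simp: anc_low anc_high)
qed

text \<open>Beyond depth \<open>n\<close> a vertex and its parent share their ancestor; up to depth
  \<open>n\<close> each is its own. The remainder in \<open>Diff_sub_anc\<close> receives exactly
  the differences lost here.\<close>

lemma Diff_anc:
  assumes "v \<noteq> r"
  shows "Diff (\<lambda>v. f (anc n v)) v = (if dep v \<le> n then Diff f v else 0)"
  using parent_props[OF assms] by (auto simp: tree_diff_def anc_low anc_high)

lemma Diff_sub_anc:
  assumes "v \<noteq> r"
  shows "Diff (\<lambda>v. f v - f (anc n v)) v = (if dep v \<le> n then 0 else Diff f v)"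
  using parent_props[OF assms] by (auto simp: tree_diff_def anc_low anc_high)

subsection \<open>The Lipschitz spaces\<close>

lemma Diff_nonneg: "0 \<le> Diff f v"
  by (simp add: tree_diff_def)

lemma Diff_add: "Diff (\<lambda>v. f v + g v) v \<le> Diff f v + Diff g v"
  unfolding tree_diff_def using norm_triangle_ineq[of "f v - f (par v)" "g v - g (par v)"]
  by (simp add: algebra_simps)

lemma Diff_mult: "Diff (\<lambda>v. c * f v) v = cmod c * Diff f v"
  unfolding tree_diff_def by (simp add: norm_mult flip: right_diff_distrib)

lemma Lip_bound:
  assumes "f \<in> elems Lip" "v \<noteq> r"
  shows "cmod (f r) + Diff f v \<le> fnorm Lip f"
  using assms cSUP_upper[of v "- {r}" "Diff f"] by (simp add: lipschitz_space_def)

text \<open>With \<open>Lip_bound\<close>, this presents the norm as a least upper bound, so later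
  estimates run vertex by vertex. The real supremum obeys it because some vertex differs from the
  root.\<close>

lemma Lip_least:
  assumes "\<And>v. v \<noteq> r \<Longrightarrow> cmod (f r) + Diff f v \<le> C"
  shows "f \<in> elems Lip" "fnorm Lip f \<le> C"
proof -
  have *: "Diff f v \<le> C - cmod (f r)" if "v \<in> - {r}" for v using assms[of v] that by auto
  then show "f \<in> elems Lip" by (auto simp: lipschitz_space_def intro!: bdd_aboveI2)
  show "fnorm Lip f \<le> C"
    using cSUP_least[OF nonroot_nonempty, of "Diff f", OF *] by (simp add: lipschitz_space_def)
qed

lemma WLip_bound:
  assumes "f \<in> elems WLip" "v \<noteq> r"
  shows "cmod (f r) + real (dep v) * Diff f v \<le> fnorm WLip f"
  using assms cSUP_upper[of v "- {r}" "\<lambda>v. real (dep v) * Diff f v"]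
  by (simp add: weighted_lipschitz_space_def)

lemma WLip_mem:
  assumes "\<And>v. v \<noteq> r \<Longrightarrow> real (dep v) * Diff f v \<le> C"
  shows "f \<in> elems WLip"
  using assms by (auto simp: weighted_lipschitz_space_def intro!: bdd_aboveI2)

lemma Lip_norm_nonneg: "f \<in> elems Lip \<Longrightarrow> 0 \<le> fnorm Lip f"
  using Lip_bound[of f] nonroot_nonempty Diff_nonneg[of f] norm_ge_zero[of "f r"]
  by (metis ComplD add_nonneg_nonneg ex_in_conv order_trans singletonI)

lemma Lip_add:
  assumes "f \<in> elems Lip" "g \<in> elems Lip"
  shows "(\<lambda>v. f v + g v) \<in> elems Lip" "fnorm Lip (\<lambda>v. f v + g v) \<le> fnorm Lip f + fnorm Lip g"
proof -
  have *: "cmod (f r + g r) + Diff (\<lambda>v. f v + g v) v \<le> fnorm Lip f + fnorm Lip g" if "v \<noteq> r" for v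
    using Lip_bound[OF assms(1) that] Lip_bound[OF assms(2) that] Diff_add[of f g v]
      norm_triangle_ineq[of "f r" "g r"] by linarith
  show "(\<lambda>v. f v + g v) \<in> elems Lip" "fnorm Lip (\<lambda>v. f v + g v) \<le> fnorm Lip f + fnorm Lip g"
    using Lip_least[of "\<lambda>v. f v + g v", OF *] by auto
qed

lemma Lip_mult:
  assumes "f \<in> elems Lip"
  shows "(\<lambda>v. c * f v) \<in> elems Lip" "fnorm Lip (\<lambda>v. c * f v) \<le> cmod c * fnorm Lip f"
proof -
  have *: "cmod (c * f r) + Diff (\<lambda>v. c * f v) v \<le> cmod c * fnorm Lip f" if "v \<noteq> r" for v
    using mult_left_mono[OF Lip_bound[OF assms that] norm_ge_zero[of c]]
    by (simp add: Diff_mult norm_mult distrib_left)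
  show "(\<lambda>v. c * f v) \<in> elems Lip" "fnorm Lip (\<lambda>v. c * f v) \<le> cmod c * fnorm Lip f"
    using Lip_least[of "\<lambda>v. c * f v", OF *] by auto
qed

lemma Lip_zero: "(\<lambda>v. 0) \<in> elems Lip" "fnorm Lip (\<lambda>v. 0) = 0"
proof -
  show 0: "(\<lambda>v. 0) \<in> elems Lip"
    by (rule Lip_least[where C = 0]) (simp add: tree_diff_def)
  have "fnorm Lip (\<lambda>v. 0) \<le> 0"
    by (rule Lip_least) (simp add: tree_diff_def)
  then show "fnorm Lip (\<lambda>v. 0) = 0" using Lip_norm_nonneg[OF 0] by linarith
qed

lemma Lip_diff:
  assumes "f \<in> elems Lip" "g \<in> elems Lip"
  shows "(\<lambda>v. f v - g v) \<in> elems Lip" "fnorm Lip (\<lambda>v. f v - g v) \<le> fnorm Lip f + fnorm Lip g"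
  using Lip_add[OF assms(1) Lip_mult(1)[OF assms(2), of "-1"]] Lip_mult(2)[OF assms(2), of "-1"]
  by auto

text \<open>Serves to show that a finite combination depends continuously on its
  coefficients.\<close>

lemma Lip_sum:
  assumes "finite F" "\<And>u. u \<in> F \<Longrightarrow> e u \<in> elems Lip"
  shows "(\<lambda>v. \<Sum>u\<in>F. c u * e u v) \<in> elems Lip \<and>
    fnorm Lip (\<lambda>v. \<Sum>u\<in>F. c u * e u v) \<le> (\<Sum>u\<in>F. cmod (c u) * fnorm Lip (e u))"
  using assms
proof (induction F rule: finite_induct)
  case empty
  then show ?case by (simp add: Lip_zero)
next
  case (insert x F)
  then have IH: "(\<lambda>v. \<Sum>u\<in>F. c u * e u v) \<in> elems Lip"
    "fnorm Lip (\<lambda>v. \<Sum>u\<in>F. c u * e u v) \<le> (\<Sum>u\<in>F. cmod (c u) * fnorm Lip (e u))" by auto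
  have x: "e x \<in> elems Lip" using insert by auto
  show ?case using Lip_add[OF Lip_mult(1)[OF x, of "c x"] IH(1)] Lip_mult(2)[OF x, of "c x"] IH(2)
    unfolding sum.insert[OF insert(1,2)] by linarith
qed

text \<open>Zero norm makes \<open>f\<close> vanish at the root and constant along every
  edge.\<close>

lemma Lip_norm_eq_0:
  assumes "f \<in> elems Lip" "fnorm Lip f = 0" shows "f v = 0"
proof -
  have *: "f r = 0 \<and> f v = f (par v)" if "v \<noteq> r" for v
    using Lip_bound[OF assms(1) that] Diff_nonneg[of f v] norm_ge_zero[of "f r"] assms(2)
    unfolding tree_diff_def by (smt (verit) eq_iff_diff_eq_0 zero_less_norm_iff)
  have r: "f r = 0" using * nonroot_nonempty by blast
  show ?thesis by (induction v rule: dep_induct) (use r * in auto)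
qed

section \<open>Metric and compact sets in the Lipschitz space\<close>

lemma Metric_space_Lip: "Metric_space (elems Lip) (fdist Lip)"
proof
  fix f g h :: "'v \<Rightarrow> complex"
  show "0 \<le> fdist Lip f g" by (simp add: fdist_def Lip_norm_nonneg Lip_diff)
  have "fnorm Lip (\<lambda>v. f v - g v) = fnorm Lip (\<lambda>v. g v - f v)"
  proof -
    have "Diff (\<lambda>v. f v - g v) = Diff (\<lambda>v. g v - f v)"
      using Diff_mult[of "-1" "\<lambda>v. f v - g v"] by (simp add: fun_eq_iff)
    then show ?thesis by (simp add: lipschitz_space_def norm_minus_commute)
  qed
  then show "fdist Lip f g = fdist Lip g f" by (simp add: fdist_def)
  assume f: "f \<in> elems Lip" and g: "g \<in> elems Lip"
  have "f = g" if "fnorm Lip (\<lambda>v. f v - g v) = 0"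
    using Lip_norm_eq_0[OF Lip_diff(1)[OF f g] that] by auto
  then show "(fdist Lip f g = 0) = (f = g)"
    using f g Lip_zero by (auto simp: fdist_def)
  assume h: "h \<in> elems Lip"
  show "fdist Lip f h \<le> fdist Lip f g + fdist Lip g h"
    using f g h Lip_add(2)[OF Lip_diff(1)[OF f g] Lip_diff(1)[OF g h]] by (simp add: fdist_def)
qed

text \<open>A finite product of closed discs is compact, and the map from coefficients to
  combinations is continuous by \<open>Lip_sum\<close>.\<close>

lemma compactin_linear_combinations:
  assumes F: "finite F" and e: "\<And>u. u \<in> F \<Longrightarrow> e u \<in> elems Lip"
  shows "compactin (ftopology Lip)
    ((\<lambda>c v. \<Sum>u\<in>F. c u * e u v) ` PiE F (\<lambda>u. cball (0::complex) C))"
proof -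
  interpret M: Metric_space "elems Lip" "fdist Lip" by (rule Metric_space_Lip)
  let ?X = "product_topology (\<lambda>u. euclidean :: complex topology) F"
  let ?\<Phi> = "\<lambda>c v. \<Sum>u\<in>F. c u * e u v"
  have "continuous_map ?X M.mtopology ?\<Phi>"
    unfolding M.continuous_map_to_metric
  proof (intro ballI allI impI)
    fix c and \<epsilon> :: real assume c: "c \<in> topspace ?X" and \<epsilon>: "0 < \<epsilon>"
    \<comment> \<open>This sum dominates the distance between the two combinations, is continuous in
      \<open>b\<close> and vanishes at \<open>c\<close>, so its sublevel set is the required
      neighbourhood.\<close>
    let ?g = "\<lambda>b. \<Sum>u\<in>F. cmod (c u - b u) * fnorm Lip (e u)"
    have "continuous_map ?X euclideanreal ?g"
    proof (rule continuous_map_sum[OF F])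
      fix u assume "u \<in> F"
      then have "continuous_map ?X euclidean (\<lambda>b. b u)"
        by (rule continuous_map_product_projection)
      then show "continuous_map ?X euclideanreal (\<lambda>b. cmod (c u - b u) * fnorm Lip (e u))"
        by (intro continuous_map_real_mult continuous_map_norm continuous_map_diff) auto
    qed
    then have op: "openin ?X {b \<in> topspace ?X. ?g b \<in> {..<\<epsilon>}}"
      by (rule openin_continuous_map_preimage) simp
    have mem: "?\<Phi> b \<in> elems Lip" for b using Lip_sum[of F e b, OF F e] by simp
    have "?\<Phi> b \<in> M.mball (?\<Phi> c) \<epsilon>" if "?g b < \<epsilon>" for b
    proof -
      have "(\<lambda>v. ?\<Phi> c v - ?\<Phi> b v) = ?\<Phi> (\<lambda>u. c u - b u)"
        by (simp add: sum_subtractf algebra_simps)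
      then have "fdist Lip (?\<Phi> c) (?\<Phi> b) \<le> ?g b"
        using Lip_sum[of F e "\<lambda>u. c u - b u", OF F e] mem by (simp add: fdist_def)
      then show ?thesis using that mem by simp
    qed
    then show "\<exists>U. openin ?X U \<and> c \<in> U \<and> (\<forall>y\<in>U. ?\<Phi> y \<in> M.mball (?\<Phi> c) \<epsilon>)"
      using op c \<epsilon> by (intro exI[of _ "{b \<in> topspace ?X. ?g b \<in> {..<\<epsilon>}}"]) auto
  qed
  moreover have "compactin ?X (PiE F (\<lambda>u. cball 0 C))"
    by (subst compactin_PiE) (simp add: compactin_euclidean_iff)
  ultimately show ?thesis unfolding ftopology_def by (rule image_compactin[rotated])
qed

section \<open>Growth of functions in the weighted unit ball\<close>

lemma WLip_ball_Diff:
  assumes "f \<in> closed_unit_ball WLip" "v \<noteq> r"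
  shows "cmod (f r) + real (dep v) * Diff f v \<le> 1"
  using WLip_bound[of f v] assms by (auto simp: closed_unit_ball_def)

lemma WLip_ball_Diff_le:
  assumes "f \<in> closed_unit_ball WLip" "v \<noteq> r"
  shows "Diff f v \<le> 1 / real (dep v)"
  using WLip_ball_Diff[OF assms] dep_pos[OF assms(2)] norm_ge_zero[of "f r"]
  by (simp add: pos_le_divide_eq mult.commute del: norm_ge_zero)

text \<open>Each edge on the path from the root adds at most 1. This crude bound suffices for the
  finitely many coefficients of a truncation.\<close>

lemma WLip_ball_value:
  assumes "f \<in> closed_unit_ball WLip"
  shows "cmod (f v) \<le> 1 + real (dep v)"
proof (induction v rule: dep_induct)
  case root
  obtain v where v: "v \<noteq> r" using nonroot_nonempty by auto
  have "0 \<le> real (dep v) * Diff f v" by (simp add: Diff_nonneg)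
  then show ?case using WLip_ball_Diff[OF assms v] by simp
next
  case (step v)
  have "1 / real (dep v) \<le> 1" using dep_pos[OF step(1)] by simp
  then have "cmod (f v - f (par v)) \<le> 1"
    using WLip_ball_Diff_le[OF assms step(1)] by (simp add: tree_diff_def)
  then show ?case using step parent_props(2)[OF step(1)] norm_triangle_sub[of "f v" "f (par v)"]
    by simp
qed

text \<open>The inequality \<open>ln x \<le> x - 1\<close> at \<open>x = n / (n + 1)\<close>. It
  makes the harmonic sum telescope.\<close>

lemma inverse_le_ln_diff:
  assumes "n \<ge> 1" shows "1 / real (Suc n) \<le> ln (real (Suc n)) - ln (real n)"
proof -
  have "ln (real n / real (Suc n)) \<le> real n / real (Suc n) - 1"
    using assms by (intro ln_le_minus_one) simp
  also have "\<dots> = - (1 / real (Suc n))" by (simp add: field_simps)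
  finally show ?thesis using assms by (simp add: ln_div)
qed

text \<open>The edge from \<open>v\<close> to its parent costs at most
  \<open>1 / real (dep v)\<close>, hence at most one logarithmic increment; these telescope down to
  depth \<open>n\<close>. The root case is vacuous because \<open>n \<ge> 1\<close>.\<close>

lemma WLip_ball_sub_anc:
  assumes "f \<in> closed_unit_ball WLip" "n \<ge> 1"
  shows "n \<le> dep v \<Longrightarrow> cmod (f v - f (anc n v)) \<le> ln (real (dep v)) - ln (real n)"
proof (induction v rule: dep_induct)
  case root
  then show ?case using assms by simp
next
  case (step v)
  note d = parent_props(2)[OF step(1)]
  show ?case
  proof (cases "dep v = n")
    case True
    then show ?thesis by (simp add: anc_low)
  next
    case False
    then have n: "n < dep v" "n \<le> dep (par v)" using step d by auto
    have "cmod (f v - f (anc n v)) \<le> cmod (f v - f (par v)) + cmod (f (par v) - f (anc n (par v)))"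
      using norm_triangle_ineq[of "f v - f (par v)" "f (par v) - f (anc n (par v))"] n
      by (simp add: anc_high)
    also have "\<dots> \<le> 1 / real (dep v) + (ln (real (dep (par v))) - ln (real n))"
      using WLip_ball_Diff_le[OF assms(1) step(1)] step(2)[OF n(2)] by (simp add: tree_diff_def)
    finally show ?thesis
      using inverse_le_ln_diff[of "dep (par v)"] n assms(2) d by simp
  qed
qed

lemma WLip_zero_ball: "(\<lambda>v. 0) \<in> closed_unit_ball WLip"
  using nonroot_nonempty WLip_mem[of "\<lambda>v. 0" 0]
  by (simp add: closed_unit_ball_def weighted_lipschitz_space_def tree_diff_def)

subsection \<open>The truncated multiplication operators\<close>

definition trunc_mult :: "('v \<Rightarrow> complex) \<Rightarrow> nat \<Rightarrow> 'v operator" where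
  "trunc_mult \<psi> n f = (\<lambda>v. \<psi> v * f (anc n v))"

text \<open>Truncation keeps each difference or sets it to 0. Staying in the weighted space lets the
  mapping property of \<open>mult_operator \<psi>\<close> apply to truncated functions.\<close>

lemma anc_WLip:
  assumes "f \<in> elems WLip" shows "(\<lambda>v. f (anc n v)) \<in> elems WLip"
proof (rule WLip_mem)
  fix v assume v: "v \<noteq> r"
  have "0 \<le> real (dep v) * Diff f v" by (simp add: Diff_nonneg)
  then show "real (dep v) * Diff (\<lambda>v. f (anc n v)) v \<le> fnorm WLip f"
    using WLip_bound[OF assms v] norm_ge_zero[of "f r"]
    unfolding Diff_anc[OF v] by (auto simp del: norm_ge_zero)
qed

text \<open>The image of the unit ball lies in a set \<open>?Z\<close> of combinations with bounded
  coefficients. Being compact in a metric space, \<open>?Z\<close> is closed and so contains the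
  closure of the image.\<close>

lemma compact_trunc_mult:
  assumes "linear_operator WLip Lip (mult_operator \<psi>)"
  shows "compact_operator WLip Lip (trunc_mult \<psi> n)"
  unfolding compact_operator_def
proof
  interpret M: Metric_space "elems Lip" "fdist Lip" by (rule Metric_space_Lip)
  have maps: "(\<lambda>v. \<psi> v * f v) \<in> elems Lip" if "f \<in> elems WLip" for f
    using assms that by (simp add: linear_operator_def mult_operator_def)
  show "linear_operator WLip Lip (trunc_mult \<psi> n)"
    using maps[OF anc_WLip] by (auto simp: linear_operator_def trunc_mult_def algebra_simps)
  define F where "F = {u. dep u \<le> n}"
  have F: "finite F" unfolding F_def by (rule finite_dep_le)
  \<comment> \<open>\<open>\<psi>\<close> times the indicator of the vertices with ancestor
    \<open>u\<close>; for \<open>u\<close> in \<open>F\<close> these functions span the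
    range.\<close>
  define e where "e u v = \<psi> v * of_bool (anc n v = u)" for u v
  have e: "e u \<in> elems Lip" for u
    unfolding e_def
  proof (rule maps, rule WLip_mem)
    fix v assume v: "v \<noteq> r"
    \<comment> \<open>The indicator jumps by at most 1, and only across edges up to depth
      \<open>n\<close>, so its weighted differences are at most \<open>n\<close>.\<close>
    have "Diff (\<lambda>v. of_bool (anc n v = u)) v \<le> (if dep v \<le> n then 1 else 0)"
      using Diff_anc[OF v, of "\<lambda>w. of_bool (w = u)" n] by (simp add: tree_diff_def)
    then have "real (dep v) * Diff (\<lambda>v. of_bool (anc n v = u)) v
        \<le> real (dep v) * (if dep v \<le> n then 1 else 0)"
      by (rule mult_left_mono) simp
    also have "\<dots> \<le> real n" by simp
    finally show "real (dep v) * Diff (\<lambda>v. of_bool (anc n v = u)) v \<le> real n" .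
  qed
  let ?Z = "(\<lambda>c v. \<Sum>u\<in>F. c u * e u v) ` PiE F (\<lambda>u. cball (0::complex) (1 + real n))"
  have Z: "compactin (ftopology Lip) ?Z" by (rule compactin_linear_combinations[OF F e])
  have "trunc_mult \<psi> n ` closed_unit_ball WLip \<subseteq> ?Z"
  proof
    fix h assume "h \<in> trunc_mult \<psi> n ` closed_unit_ball WLip"
    then obtain f where f: "f \<in> closed_unit_ball WLip" and h: "h = trunc_mult \<psi> n f" by blast
    \<comment> \<open>The coefficients are the values of \<open>f\<close> on the ball, restricted
      because members of \<open>PiE\<close> are undefined elsewhere.\<close>
    have "restrict f F \<in> PiE F (\<lambda>u. cball 0 (1 + real n))"
      unfolding F_def by (auto intro!: order_trans[OF WLip_ball_value[OF f]])
    moreover have "h = (\<lambda>v. \<Sum>u\<in>F. restrict f F u * e u v)"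
    proof
      fix v
      have "(\<Sum>u\<in>F. restrict f F u * e u v) = (\<Sum>u\<in>F. if u = anc n v then f u * \<psi> v else 0)"
        by (rule sum.cong) (auto simp: e_def)
      also have "\<dots> = h v"
        using F dep_anc_le[of n v] by (simp add: sum.delta' h trunc_mult_def F_def mult.commute)
      finally show "h v = (\<Sum>u\<in>F. restrict f F u * e u v)" by simp
    qed
    ultimately show "h \<in> ?Z" by blast
  qed
  moreover have "closedin (ftopology Lip) ?Z"
    using Z M.Hausdorff_space_mtopology compactin_imp_closedin unfolding ftopology_def by blast
  ultimately have "ftopology Lip closure_of (trunc_mult \<psi> n ` closed_unit_ball WLip) \<subseteq> ?Z"
    by (rule closure_of_minimal)
  then show "compactin (ftopology Lip) (ftopology Lip closure_of (trunc_mult \<psi> n ` closed_unit_ball WLip))"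
    by (rule closed_compactin[OF Z]) simp
qed

text \<open>The product rule produces \<open>cmod (\<psi> v) / real (dep v)\<close>, whereas
  \<open>a\<close> bounds the quotient by \<open>real (dep v) + 1\<close>. Changing the denominator
  costs \<open>1 + 1 / real (dep v)\<close>, at most \<open>1 + 1 / real n\<close>.\<close>

lemma operator_norm_trunc_le:
  assumes n: "n \<ge> 1"
    and a: "\<And>v. dep v > n \<Longrightarrow> cmod (\<psi> v) / (real (dep v) + 1) \<le> a"
    and b: "\<And>v. dep v > n \<Longrightarrow> Diff \<psi> v * ln (real (dep v)) \<le> b"
  shows "operator_norm WLip Lip (\<lambda>f v. mult_operator \<psi> f v - trunc_mult \<psi> n f v)
    \<le> (1 + 1 / real n) * a + b"
  unfolding operator_norm_def
proof (rule cSUP_least)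
  show "closed_unit_ball WLip \<noteq> {}" using WLip_zero_ball by blast
next
  fix f assume f: "f \<in> closed_unit_ball WLip"
  \<comment> \<open>A vertex beyond depth \<open>n\<close> shows that \<open>a\<close> and
    \<open>b\<close> are nonnegative, as is needed where \<open>g\<close> vanishes on both ends of
    an edge.\<close>
  obtain w where w: "dep w > n" using ex_dep_gt by blast
  have "0 \<le> cmod (\<psi> w) / (real (dep w) + 1)" by simp
  with a[OF w] have a0: "a \<ge> 0" by linarith
  have "0 \<le> Diff \<psi> w * ln (real (dep w))" using w by (simp add: Diff_nonneg)
  with b[OF w] have b0: "b \<ge> 0" by linarith
  define g where "g v = f v - f (anc n v)" for v
  have gr: "g r = 0" by (simp add: g_def anc_low)
  have "fnorm Lip (\<lambda>v. \<psi> v * g v) \<le> (1 + 1 / real n) * a + b"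
  proof (rule Lip_least)
    fix v assume v: "v \<noteq> r"
    note d = parent_props(2)[OF v]
    have "Diff (\<lambda>v. \<psi> v * g v) v \<le> (1 + 1 / real n) * a + b"
    proof (cases "dep v \<le> n")
      case True
      then have "g v = 0" "g (par v) = 0" using d by (simp_all add: g_def anc_low)
      then show ?thesis using a0 b0 by (simp add: tree_diff_def)
    next
      case False
      then have k: "n < dep v" "n \<le> dep (par v)" using d by auto
      have g: "Diff g v \<le> 1 / real (dep v)"
        using WLip_ball_Diff_le[OF f v] Diff_sub_anc[OF v, of f n] False
        unfolding g_def[abs_def] by simp
      have "cmod (g (par v)) \<le> ln (real (dep (par v))) - ln (real n)"
        unfolding g_def by (rule WLip_ball_sub_anc[OF f n k(2)])
      \<comment> \<open>Weakened to the logarithmic weight that \<open>b\<close> controls at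
        \<open>v\<close> itself.\<close>
      also have "\<dots> \<le> ln (real (dep v))"
      proof -
        have "0 \<le> ln (real n)" using n by simp
        moreover have "ln (real (dep (par v))) \<le> ln (real (dep v))" using n k d by simp
        ultimately show ?thesis by linarith
      qed
      finally have gp: "cmod (g (par v)) \<le> ln (real (dep v))" .
      \<comment> \<open>The splitting takes \<open>\<psi>\<close> at \<open>v\<close>, where
        \<open>a\<close> applies, and \<open>g\<close> at the parent, where the logarithmic bound
        was just obtained.\<close>
      have "\<psi> v * g v - \<psi> (par v) * g (par v)
          = \<psi> v * (g v - g (par v)) + (\<psi> v - \<psi> (par v)) * g (par v)"
        by (simp add: algebra_simps)
      then have "Diff (\<lambda>v. \<psi> v * g v) v \<le> cmod (\<psi> v) * Diff g v + Diff \<psi> v * cmod (g (par v))"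
        unfolding tree_diff_def by (metis norm_mult norm_triangle_ineq)
      also have "\<dots> \<le> cmod (\<psi> v) * (1 / real (dep v)) + Diff \<psi> v * ln (real (dep v))"
        using g gp by (intro add_mono mult_left_mono) (auto simp: Diff_nonneg)
      also have "cmod (\<psi> v) * (1 / real (dep v))
          = cmod (\<psi> v) / (real (dep v) + 1) * (1 + 1 / real (dep v))"
        using k by (simp add: divide_simps)
      also have "\<dots> \<le> a * (1 + 1 / real n)"
        using a[OF k(1)] a0 k n by (intro mult_mono add_left_mono divide_left_mono) auto
      finally show ?thesis using b[OF k(1)] by (simp add: mult.commute)
    qed
    then show "cmod (\<psi> r * g r) + Diff (\<lambda>v. \<psi> v * g v) v \<le> (1 + 1 / real n) * a + b"
      by (simp add: gr)
  qed
  moreover have "(\<lambda>v. mult_operator \<psi> f v - trunc_mult \<psi> n f v) = (\<lambda>v. \<psi> v * g v)"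
    by (auto simp: mult_operator_def trunc_mult_def g_def algebra_simps)
  ultimately show "fnorm Lip (\<lambda>v. mult_operator \<psi> f v - trunc_mult \<psi> n f v)
    \<le> (1 + 1 / real n) * a + b" by simp
qed

section \<open>Operator norms and the essential norm\<close>

lemma compact_operator_bounded:
  assumes "compact_operator WLip Lip K"
  shows "\<exists>B. \<forall>f\<in>closed_unit_ball WLip. fnorm Lip (K f) \<le> B"
proof -
  interpret M: Metric_space "elems Lip" "fdist Lip" by (rule Metric_space_Lip)
  have K: "K f \<in> elems Lip" if "f \<in> closed_unit_ball WLip" for f
    using assms that by (auto simp: compact_operator_def linear_operator_def closed_unit_ball_def)
  have "M.mbounded (M.mtopology closure_of (K ` closed_unit_ball WLip))"
    using assms M.compactin_imp_mbounded by (simp add: compact_operator_def ftopology_def)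
  then have "M.mbounded (K ` closed_unit_ball WLip)"
    using M.mbounded_closure_of_eq K by (metis M.topspace_mtopology image_subset_iff)
  \<comment> \<open>With the zero function added as a reference point, bounded distances become
    bounded norms.\<close>
  then have "M.mbounded (insert (\<lambda>v. 0) (K ` closed_unit_ball WLip))"
    using Lip_zero(1) by (simp add: M.mbounded_insert)
  then obtain B where B: "\<And>f. f \<in> closed_unit_ball WLip \<Longrightarrow> fdist Lip (\<lambda>v. 0) (K f) \<le> B"
    unfolding M.mbounded_alt by blast
  have "fnorm Lip (K f) \<le> B" if "f \<in> closed_unit_ball WLip" for f
  proof -
    have "fdist Lip (K f) (\<lambda>v. 0) = fnorm Lip (K f)"
      using K[OF that] Lip_zero by (simp add: fdist_def)
    then show ?thesis using B[OF that] M.commute by metis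
  qed
  then show ?thesis by blast
qed

text \<open>A real infimum is a lower bound only for sets bounded below. Evaluation at the zero
  function gives the bound 0, once boundedness of \<open>S\<close> and \<open>K\<close> makes the
  suprema over the unit ball finite.\<close>

lemma essential_norm_le:
  assumes S: "bounded_operator WLip Lip S" and K: "compact_operator WLip Lip K"
  shows "essential_norm WLip Lip S \<le> operator_norm WLip Lip (\<lambda>f v. S f v - K f v)"
  unfolding essential_norm_def
proof (rule cInf_lower)
  show "operator_norm WLip Lip (\<lambda>f v. S f v - K f v)
      \<in> {operator_norm WLip Lip (\<lambda>f v. S f v - K f v) |K. compact_operator WLip Lip K}"
    using K by blast
  have "0 \<le> operator_norm WLip Lip (\<lambda>f v. S f v - K f v)" if K: "compact_operator WLip Lip K" for K
  proof -
    obtain C where C: "\<And>f. f \<in> elems WLip \<Longrightarrow> fnorm Lip (S f) \<le> C * fnorm WLip f"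
      using S by (auto simp: bounded_operator_def)
    obtain B where B: "\<And>f. f \<in> closed_unit_ball WLip \<Longrightarrow> fnorm Lip (K f) \<le> B"
      using compact_operator_bounded[OF K] by blast
    have mem: "S f \<in> elems Lip" "K f \<in> elems Lip" if "f \<in> closed_unit_ball WLip" for f
      using S K that
      by (auto simp: bounded_operator_def compact_operator_def linear_operator_def closed_unit_ball_def)
    \<comment> \<open>\<open>C\<close> has no assumed sign and \<open>fnorm WLip f\<close> lies
      between 0 and 1, hence the absolute value.\<close>
    have S_le: "fnorm Lip (S f) \<le> \<bar>C\<bar>" if f: "f \<in> closed_unit_ball WLip" for f
    proof -
      obtain v where v: "v \<noteq> r" using nonroot_nonempty by auto
      have f': "f \<in> elems WLip" "fnorm WLip f \<le> 1" using f by (auto simp: closed_unit_ball_def)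
      have "0 \<le> cmod (f r) + real (dep v) * Diff f v" by (simp add: Diff_nonneg)
      then have "0 \<le> fnorm WLip f" using WLip_bound[OF f'(1) v] by linarith
      then have "C * fnorm WLip f \<le> \<bar>C\<bar> * 1" using f'(2) by (intro mult_mono) auto
      then show ?thesis using C[OF f'(1)] by simp
    qed
    have "bdd_above ((\<lambda>f. fnorm Lip (\<lambda>v. S f v - K f v)) ` closed_unit_ball WLip)"
    proof (rule bdd_aboveI2)
      fix f assume f: "f \<in> closed_unit_ball WLip"
      show "fnorm Lip (\<lambda>v. S f v - K f v) \<le> \<bar>C\<bar> + B"
        using Lip_diff(2)[OF mem[OF f]] S_le[OF f] B[OF f] by linarith
    qed
    from cSUP_upper[OF WLip_zero_ball this] Lip_norm_nonneg[OF Lip_diff(1)[OF mem[OF WLip_zero_ball]]]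
    show ?thesis unfolding operator_norm_def by linarith
  qed
  then show "bdd_below {operator_norm WLip Lip (\<lambda>f v. S f v - K f v) |K. compact_operator WLip Lip K}"
    by (auto intro!: bdd_belowI[of _ 0])
qed

section \<open>Tail suprema and the passage to the limit\<close>

lemma A_limit_eq: "A_limit adj r \<psi> = (INF n. SUP v\<in>{v. n \<le> dep v}.
    ereal (cmod (\<psi> v) / (real (dep v) + 1)))"
  unfolding A_limit_def
  \<comment> \<open>The index sets shrink with \<open>n\<close>, so the suprema decrease to their
    infimum.\<close>
  by (intro limI LIMSEQ_INF) (auto simp: decseq_def intro!: SUP_subset_mono)

lemma B_limit_eq: "B_limit adj r \<psi> = (INF n. SUP v\<in>{v. v \<noteq> r \<and> n \<le> dep v}.
    ereal (Diff \<psi> v * ln (real (dep v))))"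
  unfolding B_limit_def
  by (intro limI LIMSEQ_INF) (auto simp: decseq_def intro!: SUP_subset_mono)

text \<open>A strict upper bound of an infimum already holds for one tail, so \<open>a\<close> and
  \<open>b\<close> satisfy the hypotheses of \<open>operator_norm_trunc_le\<close> for all large
  \<open>n\<close>. Letting \<open>n\<close> tend to infinity removes
  \<open>1 / real n\<close>.\<close>

lemma essential_norm_less:
  assumes S: "bounded_operator WLip Lip (mult_operator \<psi>)"
    and a: "A_limit adj r \<psi> < ereal a" and b: "B_limit adj r \<psi> < ereal b"
  shows "essential_norm WLip Lip (mult_operator \<psi>) \<le> a + b"
proof -
  obtain N1 where N1: "(SUP v\<in>{v. N1 \<le> dep v}. ereal (cmod (\<psi> v) / (real (dep v) + 1))) < ereal a"
    using a by (auto simp: A_limit_eq INF_less_iff)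
  obtain N2 where N2: "(SUP v\<in>{v. v \<noteq> r \<and> N2 \<le> dep v}. ereal (Diff \<psi> v * ln (real (dep v)))) < ereal b"
    using b by (auto simp: B_limit_eq INF_less_iff)
  have "essential_norm WLip Lip (mult_operator \<psi>) \<le> (1 + 1 / real n) * a + b"
    if n: "n \<ge> Suc (max N1 N2)" for n
  proof -
    have "operator_norm WLip Lip (\<lambda>f v. mult_operator \<psi> f v - trunc_mult \<psi> n f v)
        \<le> (1 + 1 / real n) * a + b"
    proof (rule operator_norm_trunc_le)
      show "n \<ge> 1" using n by simp
    next
      fix v assume v: "dep v > n"
      then have "v \<in> {v. N1 \<le> dep v}" using n by simp
      then have "ereal (cmod (\<psi> v) / (real (dep v) + 1)) < ereal a"
        by (rule le_less_trans[OF SUP_upper N1])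
      then show "cmod (\<psi> v) / (real (dep v) + 1) \<le> a" by simp
      have "v \<in> {v. v \<noteq> r \<and> N2 \<le> dep v}" using n v by auto
      then have "ereal (Diff \<psi> v * ln (real (dep v))) < ereal b"
        by (rule le_less_trans[OF SUP_upper N2])
      then show "Diff \<psi> v * ln (real (dep v)) \<le> b" by simp
    qed
    moreover have "compact_operator WLip Lip (trunc_mult \<psi> n)"
      using S compact_trunc_mult by (auto simp: bounded_operator_def)
    ultimately show ?thesis using essential_norm_le[OF S] by fastforce
  qed
  moreover have "(\<lambda>n. (1 + 1 / real n) * a + b) \<longlonglongrightarrow> (1 + 0) * a + b"
    by (intro tendsto_intros lim_1_over_n)
  ultimately show ?thesis by (intro LIMSEQ_le_const[where a = "essential_norm _ _ _"]) auto
qed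

end

theorem theorem2p8:
  fixes adj :: "'v \<Rightarrow> 'v \<Rightarrow> bool" and r :: 'v and \<psi> :: "'v \<Rightarrow> complex"
  assumes "infinite_tree adj"
    and "bounded_operator (weighted_lipschitz_space adj r) (lipschitz_space adj r)
           (mult_operator \<psi>)"
  shows "ereal (essential_norm (weighted_lipschitz_space adj r) (lipschitz_space adj r)
           (mult_operator \<psi>)) \<le> A_limit adj r \<psi> + B_limit adj r \<psi>"
proof -
  interpret rooted_tree adj r using assms(1) by (simp add: rooted_tree_def)
  let ?E = "essential_norm WLip Lip (mult_operator \<psi>)"
  note le = essential_norm_less[OF assms(2)]
  show ?thesis
  \<comment> \<open>For \<open>ereal\<close>, a sum with a summand \<open>\<infinity>\<close> is
    \<open>\<infinity>\<close>, whatever the other summand.\<close>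
  proof (cases "A_limit adj r \<psi> = \<infinity> \<or> B_limit adj r \<psi> = \<infinity>")
    case True
    then show ?thesis by auto
  next
    case False
    show ?thesis
    proof (rule ccontr)
      assume "\<not> ?thesis"
      then have "A_limit adj r \<psi> + B_limit adj r \<psi> < ereal ?E" by simp
      \<comment> \<open>For finite limits each receives a third of the gap to \<open>?E\<close>,
        which leaves the last third for strictness.\<close>
      then obtain a b where "A_limit adj r \<psi> < ereal a" "B_limit adj r \<psi> < ereal b" "a + b < ?E"
        using False
      proof (cases "A_limit adj r \<psi>"; cases "B_limit adj r \<psi>")
        fix x y assume xy: "A_limit adj r \<psi> = ereal x" "B_limit adj r \<psi> = ereal y"
        assume "A_limit adj r \<psi> + B_limit adj r \<psi> < ereal ?E"
        then show ?thesis
          using xy that[of "x + (?E - x - y) / 3" "y + (?E - x - y) / 3"] by (simp add: field_simps)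
      next
        \<comment> \<open>Both limits are in fact nonnegative; the cases with
          \<open>- \<infinity>\<close> are closed directly by a choice of reals with sum
          \<open>?E - 1\<close>.\<close>
        fix x assume "A_limit adj r \<psi> = ereal x" "B_limit adj r \<psi> = - \<infinity>"
        then show ?thesis using that[of "x + 1" "?E - x - 2"] by simp
      next
        fix y assume "A_limit adj r \<psi> = - \<infinity>" "B_limit adj r \<psi> = ereal y"
        then show ?thesis using that[of "?E - y - 2" "y + 1"] by simp
      next
        assume "A_limit adj r \<psi> = - \<infinity>" "B_limit adj r \<psi> = - \<infinity>"
        then show ?thesis using that[of "?E - 1" 0] by simp
      qed auto
      then show False using le by fastforce
    qed
  qed
qed

end
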